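(* The $3$-EDA problem (Exact Diameter-$3$ Augmentation) is solvable in polynomial time. That is, there is a polynomial-time algorithm which, given a connected graph $G$, decides whether there is a set $F\subseteq E(G)$ such that $G-F$ is a connected graph of diameter exactly $3$.
   Context: All graphs are finite, simple and undirected. For $F\subseteq E(G)$, $G-F$ is the graph with vertex set $V(G)$ and edge set $E(G)\setminus F$. The diameter of a connected graph $G$ is $\mathrm{diam}(G)=\max_{u,v\in V(G)}\mathrm{dist}_G(u,v)$, where $\mathrm{dist}_G(u,v)$ is the minimum number of edges of a $u,v$-path. For a fixed positive integer $d$, the Exact Diameter-$d$ Augmentation problem ($d$-EDA) is the following decision problem. Input: a connected graph $G$. Question: is there a set $F\subseteq E(G)$ such that $G-F$ is a connected graph of diameter $d$? *)

theory Defs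
  imports Main "HOL-Computational_Algebra.Polynomial"
begin

section \<open>Finite simple undirected graphs\<close>

type_synonym 'a graph = "'a set \<times> 'a set set"

abbreviation verts :: "'a graph \<Rightarrow> 'a set" where "verts \<equiv> fst"
abbreviation edges :: "'a graph \<Rightarrow> 'a set set" where "edges \<equiv> snd"

definition simple_graph :: "'a graph \<Rightarrow> bool" where
  "simple_graph G \<longleftrightarrow> finite (verts G) \<and> (\<forall>e\<in>edges G. e \<subseteq> verts G \<and> card e = 2)"

definition delete_edges :: "'a graph \<Rightarrow> 'a set set \<Rightarrow> 'a graph" where
  "delete_edges G F = (verts G, edges G - F)"

text \<open>A path is given by its list of vertices, so it has \<open>length xs - 1\<close> edges.\<close>

definition is_path :: "'a graph \<Rightarrow> 'a \<Rightarrow> 'a list \<Rightarrow> 'a \<Rightarrow> bool" where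
  "is_path G u xs v \<longleftrightarrow>
     xs \<noteq> [] \<and> hd xs = u \<and> last xs = v \<and> distinct xs \<and> set xs \<subseteq> verts G \<and>
     (\<forall>i. Suc i < length xs \<longrightarrow> {xs ! i, xs ! Suc i} \<in> edges G)"

definition connected_graph :: "'a graph \<Rightarrow> bool" where
  "connected_graph G \<longleftrightarrow>
     verts G \<noteq> {} \<and> (\<forall>u\<in>verts G. \<forall>v\<in>verts G. \<exists>xs. is_path G u xs v)"

text \<open>Distance and diameter are only meaningful for connected graphs; every use below is guarded
  by \<^const>\<open>connected_graph\<close>.\<close>

definition graph_dist :: "'a graph \<Rightarrow> 'a \<Rightarrow> 'a \<Rightarrow> nat" where
  "graph_dist G u v = (LEAST k. \<exists>xs. is_path G u xs v \<and> length xs = Suc k)"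

definition diam :: "'a graph \<Rightarrow> nat" where
  "diam G = Max {graph_dist G u v | u v. u \<in> verts G \<and> v \<in> verts G}"

definition EDA :: "nat \<Rightarrow> 'a graph \<Rightarrow> bool" where
  "EDA d G \<longleftrightarrow>
     (\<exists>F\<subseteq>edges G. connected_graph (delete_edges G F) \<and> diam (delete_edges G F) = d)"


section \<open>Polynomial time\<close>

text \<open>
  The model of computation is the random access machine with addition and (truncated) subtraction,
  indirect addressing and conditional jumps, under the uniform cost criterion (every instruction
  takes one step). There is no multiplication, so \<open>t\<close> steps can only create numbers with
  \<open>O(t + log m)\<close> bits, where \<open>m\<close> bounds the initial contents and the constants of the program;
  hence polynomial time on this machine is the same as polynomial time on a Turing machine.

  A program is a finite list of instructions and so mentions finitely many registers; the registers
  are kept apart from the indirectly addressed memory.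
\<close>

datatype instr =
    Const nat nat      \<comment> \<open>\<open>Const i c\<close>:  \<open>R i := c\<close>\<close>
  | Add nat nat nat    \<comment> \<open>\<open>Add i j k\<close>:  \<open>R i := R j + R k\<close>\<close>
  | Sub nat nat nat    \<comment> \<open>\<open>Sub i j k\<close>:  \<open>R i := R j - R k\<close>, truncated at 0\<close>
  | Load nat nat       \<comment> \<open>\<open>Load i j\<close>:  \<open>R i := M (R j)\<close>\<close>
  | Store nat nat      \<comment> \<open>\<open>Store i j\<close>:  \<open>M (R i) := R j\<close>\<close>
  | Jump_zero nat nat  \<comment> \<open>\<open>Jump_zero i l\<close>:  continue at instruction \<open>l\<close> if \<open>R i = 0\<close>\<close>

type_synonym program = "instr list"

datatype config = Config (pc: nat) (reg: "nat \<Rightarrow> nat") (mem: "nat \<Rightarrow> nat")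

fun exec :: "instr \<Rightarrow> config \<Rightarrow> config" where
  "exec (Const i c) (Config l R M) = Config (Suc l) (R(i := c)) M"
| "exec (Add i j k) (Config l R M) = Config (Suc l) (R(i := R j + R k)) M"
| "exec (Sub i j k) (Config l R M) = Config (Suc l) (R(i := R j - R k)) M"
| "exec (Load i j) (Config l R M) = Config (Suc l) (R(i := M (R j))) M"
| "exec (Store i j) (Config l R M) = Config (Suc l) R (M(R i := R j))"
| "exec (Jump_zero i l') (Config l R M) = Config (if R i = 0 then l' else Suc l) R M"

definition halted :: "program \<Rightarrow> config \<Rightarrow> bool" where
  "halted P c \<longleftrightarrow> length P \<le> pc c"

definition step :: "program \<Rightarrow> config \<Rightarrow> config" where
  "step P c = (if halted P c then c else exec (P ! pc c) c)"

text \<open>The input word is in memory cells \<open>0, 1, \<dots>\<close> and its length in register 0; everything else is 0.\<close>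

definition init :: "bool list \<Rightarrow> config" where
  "init w = Config 0 (\<lambda>i. if i = 0 then length w else 0)
                     (\<lambda>a. if a < length w \<and> w ! a then 1 else 0)"

text \<open>
  A decision problem consists of a set of instances, a question and an encoding of the instances as
  bit strings. Halted configurations are fixed by \<^const>\<open>step\<close>, so being halted after exactly
  \<open>t\<close> steps means halting within \<open>t\<close> steps. The answer is left in register 0.
\<close>

definition poly_time_solvable :: "'i set \<Rightarrow> ('i \<Rightarrow> bool) \<Rightarrow> ('i \<Rightarrow> bool list) \<Rightarrow> bool" where
  "poly_time_solvable Inst Q enc \<longleftrightarrow>
     (\<exists>(P :: program) (p :: nat poly). \<forall>x\<in>Inst.
        let c = (step P ^^ poly p (length (enc x))) (init (enc x))
        in halted P c \<and> reg c 0 = (if Q x then 1 else 0))"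


section \<open>Graphs as inputs\<close>

text \<open>Input graphs have vertex set \<open>{0, \<dots>, n - 1}\<close> and are given by their adjacency matrix, row by row.\<close>

definition connected_instances :: "nat graph set" where
  "connected_instances =
     {G. simple_graph G \<and> connected_graph G \<and> (\<exists>n. verts G = {..<n})}"

definition adjacency_matrix :: "nat graph \<Rightarrow> bool list" where
  "adjacency_matrix G =
     [{u, v} \<in> edges G. u \<leftarrow> [0..<card (verts G)], v \<leftarrow> [0..<card (verts G)]]"

end

(* For a connected graph G, EDA 3 G holds iff all distances in G are at most 3 and, moreover, either
   some distance is 3 or G has at least four vertices and a cycle of length 3 or 4. Deleting an edge
   that lies on no such cycle creates a distance of at least 4. Conversely, if all distances are at
   most 2, deleting an edge of a short cycle gives distances at most 3, so one can go on deleting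
   until a distance 3 appears or no short cycle is left; in the latter case the choice of the last
   edge can be corrected.

   This criterion is a first-order sentence over the adjacency relation, and every such sentence is
   decided in polynomial time by nested loops over the vertices. *)

theory Submission imports Defs begin

section \<open>Deletions to diameter 3\<close>

text \<open>Distances stay at most 3 after one deletion for a local reason: a path of at most two
  edges uses xy only if it starts or ends in x or y, and such an end can first step to its other
  neighbour on the cycle. The detour between x and y themselves has two or three edges, which
  singles out triangles and 4-cycles. The deletion can be repeated only while all distances stay at
  most 2. The obstacle is to arrive at a graph with distances at most 2 and no short cycle, such as
  a star or the Petersen graph, where every further deletion goes too far. In that case the last
  deleted edge xy lay on a triangle x y z, and xz or yz is deleted in its place. This requires a
  vertex outside the triangle: a triangle alone has a short cycle, but its connected deletions have
  diameter at most 2.\<close>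

definition adj :: "'a graph \<Rightarrow> 'a \<Rightarrow> 'a \<Rightarrow> bool" where
  "adj G u v \<longleftrightarrow> {u, v} \<in> edges G"

text \<open>Walks with idle steps instead of paths: the recursion carries no distinctness condition
  and can be copied literally into a first-order formula.\<close>

primrec near :: "'a graph \<Rightarrow> nat \<Rightarrow> 'a \<Rightarrow> 'a \<Rightarrow> bool" where
  "near G 0 u v \<longleftrightarrow> u = v"
| "near G (Suc k) u v \<longleftrightarrow> (\<exists>m\<in>verts G. near G k u m \<and> (m = v \<or> adj G m v))"

lemma adj_sym: "adj G u v \<longleftrightarrow> adj G v u"
  by (simp add: adj_def insert_commute)

lemma adj_vertsD: "u \<in> verts G \<and> v \<in> verts G \<and> u \<noteq> v" if "simple_graph G" "adj G u v"
proof -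
  have "{u, v} \<subseteq> verts G" "card {u, v} = 2"
    using that unfolding simple_graph_def adj_def by auto
  then show ?thesis by (auto simp: card_insert_if split: if_splits)
qed

lemma verts_delete_edges [simp]: "verts (delete_edges G F) = verts G"
  by (simp add: delete_edges_def)

lemma edges_delete_edges [simp]: "edges (delete_edges G F) = edges G - F"
  by (simp add: delete_edges_def)

lemma simple_graph_delete_edges: "simple_graph (delete_edges G F)" if "simple_graph G"
  using that by (auto simp: simple_graph_def)

lemma adj_delete_edge:
  "adj (delete_edges G {{x, y}}) u v \<longleftrightarrow>
     adj G u v \<and> \<not> (u = x \<and> v = y) \<and> \<not> (u = y \<and> v = x)"
  by (auto simp: adj_def doubleton_eq_iff)

lemma is_path_within:
  assumes "is_path G u xs v" "length xs = Suc k"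
  shows "near G k u v"
  using assms
proof (induction k arbitrary: xs v)
  case 0
  then show ?case by (cases xs) (auto simp: is_path_def)
next
  case (Suc k)
  from Suc.prems(2) obtain ys w where xs: "xs = ys @ [w]"
    by (metis length_Suc_conv_rev)
  with Suc.prems have len: "length ys = Suc k" by simp
  then have ne: "ys \<noteq> []" by auto
  have e: "{xs ! i, xs ! Suc i} \<in> edges G" if "Suc i < length xs" for i
    using Suc.prems that by (auto simp: is_path_def)
  have "{ys ! i, ys ! Suc i} \<in> edges G" if "Suc i < length ys" for i
    using e[of i] that by (simp add: xs nth_append)
  then have "is_path G u ys (last ys)"
    using Suc.prems ne by (auto simp: is_path_def xs)
  then have "near G k u (last ys)" using Suc.IH len by blast
  moreover have "adj G (last ys) v"
    using e[of k] len Suc.prems(1) ne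
    by (auto simp: xs nth_append adj_def is_path_def last_conv_nth)
  moreover have "last ys \<in> verts G"
    using Suc.prems(1) ne by (auto simp: is_path_def xs)
  ultimately show ?case by auto
qed

text \<open>Distinctness is maintained along the walk: if the next vertex already lies on the path,
  the path is cut there, otherwise it is extended.\<close>

lemma within_is_path:
  assumes "simple_graph G" "near G k u v" "u \<in> verts G"
  shows "\<exists>xs. is_path G u xs v \<and> length xs \<le> Suc k"
  using assms(2)
proof (induction k arbitrary: v)
  case 0
  then show ?case using assms(3) by (intro exI[of _ "[u]"]) (auto simp: is_path_def)
next
  case (Suc k)
  then obtain m where m: "m \<in> verts G" "near G k u m" "m = v \<or> adj G m v" by auto
  then obtain xs where xs: "is_path G u xs m" "length xs \<le> Suc k" using Suc.IH by blast
  show ?case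
  proof (cases "v \<in> set xs")
    case True
    then obtain ys zs where d: "xs = ys @ v # zs" by (auto simp: in_set_conv_decomp)
    have e: "{xs ! i, xs ! Suc i} \<in> edges G" if "Suc i < length xs" for i
      using xs that by (auto simp: is_path_def)
    have "{(ys @ [v]) ! i, (ys @ [v]) ! Suc i} \<in> edges G" if "Suc i < length (ys @ [v])" for i
      using e[of i] that by (auto simp: d nth_append split: if_splits)
    then have "is_path G u (ys @ [v]) v"
      using xs(1) by (auto simp: is_path_def d hd_append split: if_splits)
    then show ?thesis using xs(2) d by (intro exI[of _ "ys @ [v]"]) auto
  next
    case False
    have ne: "xs \<noteq> []" using xs by (simp add: is_path_def)
    have a: "adj G m v" using m False xs(1) by (auto simp: is_path_def)
    have "{(xs @ [v]) ! i, (xs @ [v]) ! Suc i} \<in> edges G" if i: "Suc i < length (xs @ [v])" for i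
    proof (cases "Suc i < length xs")
      case True
      then show ?thesis using xs(1) by (auto simp: is_path_def nth_append)
    next
      case False
      then have "i = length xs - 1" using i by auto
      then show ?thesis using a xs(1) ne
        by (auto simp: is_path_def adj_def nth_append last_conv_nth)
    qed
    then have "is_path G u (xs @ [v]) v"
      using xs(1) False adj_vertsD[OF assms(1) a] by (auto simp: is_path_def)
    then show ?thesis using xs(2) by (intro exI[of _ "xs @ [v]"]) auto
  qed
qed

lemma within_mono: "near G l u v" if "near G k u v" "k \<le> l" "v \<in> verts G"
  using that(2,1)
  by (induction l rule: dec_induct) (use that(3) in auto)

definition all_within :: "'a graph \<Rightarrow> nat \<Rightarrow> bool" where
  "all_within G k \<longleftrightarrow> (\<forall>u\<in>verts G. \<forall>v\<in>verts G. near G k u v)"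

lemma graph_dist_le_iff:
  assumes "simple_graph G" "connected_graph G" "u \<in> verts G" "v \<in> verts G"
  shows "graph_dist G u v \<le> k \<longleftrightarrow> near G k u v"
proof
  obtain xs where "is_path G u xs v" using assms by (auto simp: connected_graph_def)
  then have "\<exists>k xs. is_path G u xs v \<and> length xs = Suc k"
    by (metis is_path_def length_greater_0_conv Suc_pred)
  then have "\<exists>xs. is_path G u xs v \<and> length xs = Suc (graph_dist G u v)"
    unfolding graph_dist_def by (rule LeastI_ex)
  then have "near G (graph_dist G u v) u v" using is_path_within by metis
  then show "graph_dist G u v \<le> k \<Longrightarrow> near G k u v" using within_mono assms(4) by metis
next
  assume "near G k u v"
  then obtain xs where xs: "is_path G u xs v" "length xs \<le> Suc k"
    using within_is_path assms by metis
  then obtain j where "length xs = Suc j" "j \<le> k"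
    by (metis is_path_def length_greater_0_conv Suc_pred Suc_le_mono)
  then show "graph_dist G u v \<le> k"
    unfolding graph_dist_def using xs(1) by (metis (mono_tags, lifting) Least_le le_trans)
qed

lemma diam_le_iff:
  assumes "simple_graph G" "connected_graph G"
  shows "diam G \<le> k \<longleftrightarrow> all_within G k"
proof -
  let ?D = "(\<lambda>(u, v). graph_dist G u v) ` (verts G \<times> verts G)"
  have D: "{graph_dist G u v | u v. u \<in> verts G \<and> v \<in> verts G} = ?D" by auto
  have "finite ?D" "?D \<noteq> {}"
    using assms by (auto simp: simple_graph_def connected_graph_def)
  then have "diam G \<le> k \<longleftrightarrow> (\<forall>u\<in>verts G. \<forall>v\<in>verts G. graph_dist G u v \<le> k)"
    unfolding diam_def D by (subst Max_le_iff) auto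
  then show ?thesis using graph_dist_le_iff[OF assms] by (auto simp: all_within_def)
qed

text \<open>A uniform bound on \<open>near\<close> already forces connectedness, so the guarded
  notion of diameter disappears from the rest of the argument.\<close>

lemma connected_diam_eq_iff:
  assumes "simple_graph G"
  shows "connected_graph G \<and> diam G = Suc k \<longleftrightarrow>
         verts G \<noteq> {} \<and> all_within G (Suc k) \<and> \<not> all_within G k"
proof -
  have "connected_graph G" if "verts G \<noteq> {}" "all_within G (Suc k)"
    using that within_is_path[OF assms] unfolding all_within_def connected_graph_def by blast
  then show ?thesis
    using diam_le_iff[OF assms, of k] diam_le_iff[OF assms, of "Suc k"] le_Suc_eq[of "diam G" k]
    by (metis connected_graph_def not_less_eq_eq order_refl)
qed

lemma near_2_iff:
  assumes "simple_graph G" "u \<in> verts G" "v \<in> verts G"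
  shows "near G 2 u v \<longleftrightarrow> u = v \<or> adj G u v \<or> (\<exists>m. adj G u m \<and> adj G m v)"
  using assms adj_vertsD[OF assms(1)] by (auto simp: numeral_2_eq_2)

lemma near_3_iff:
  assumes "simple_graph G" "u \<in> verts G" "v \<in> verts G"
  shows "near G 3 u v \<longleftrightarrow> u = v \<or> adj G u v \<or> (\<exists>m. adj G u m \<and> adj G m v)
     \<or> (\<exists>m m'. adj G u m \<and> adj G m m' \<and> adj G m' v)"
  using assms adj_vertsD[OF assms(1)]
  unfolding numeral_3_eq_3 by auto

section \<open>Deleting an edge of a short cycle\<close>

definition triangle :: "'a graph \<Rightarrow> 'a \<Rightarrow> 'a \<Rightarrow> 'a \<Rightarrow> bool" where
  "triangle G x y z \<longleftrightarrow> adj G x y \<and> adj G y z \<and> adj G x z"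

definition four_cycle :: "'a graph \<Rightarrow> 'a \<Rightarrow> 'a \<Rightarrow> 'a \<Rightarrow> 'a \<Rightarrow> bool" where
  "four_cycle G x y z w \<longleftrightarrow> adj G x y \<and> adj G y z \<and> adj G z w \<and> adj G w x \<and> x \<noteq> z \<and> y \<noteq> w"

definition short_cycle :: "'a graph \<Rightarrow> bool" where
  "short_cycle G \<longleftrightarrow> (\<exists>x y z. triangle G x y z) \<or> (\<exists>x y z w. four_cycle G x y z w)"

text \<open>Pairs avoiding x and y keep their paths of length at most 2. From x (or y) one step to a
  (or b) leads to such a vertex, and two more steps suffice. Only the pair x, y itself has to be
  assumed.\<close>

lemma all_within_3_delete_edge:
  assumes G: "simple_graph G" and "all_within G 2"
    and "adj G x y" and a: "adj G x a" "a \<noteq> y" and b: "adj G y b" "b \<noteq> x"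
    and xy: "near (delete_edges G {{x, y}}) 3 x y"
  shows "all_within (delete_edges G {{x, y}}) 3"
proof -
  let ?H = "delete_edges G {{x, y}}"
  have H: "simple_graph ?H" by (rule simple_graph_delete_edges[OF G])
  have two: "u = v \<or> adj G u v \<or> (\<exists>m. adj G u m \<and> adj G m v)"
    if "u \<in> verts G" "v \<in> verts G" for u v
    using assms(2) that near_2_iff[OF G] by (auto simp: all_within_def)
  have V: "x \<in> verts G" "y \<in> verts G" "a \<in> verts G" "b \<in> verts G" "x \<noteq> y" "a \<noteq> x" "b \<noteq> y"
    using assms adj_vertsD[OF G] by blast+
  have off: "u = v \<or> adj ?H u v \<or> (\<exists>m. adj ?H u m \<and> adj ?H m v)"
    if "u \<in> verts G" "v \<in> verts G" "u \<noteq> x" "u \<noteq> y" "v \<noteq> x" "v \<noteq> y" for u v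
    using two[of u v] that by (auto simp: adj_delete_edge)
  have ax: "adj ?H x a" "adj ?H y b" using a b V by (auto simp: adj_delete_edge)
  have "adj ?H u v \<Longrightarrow> adj ?H v u" for u v using adj_sym by metis
  then have sym: "near ?H 3 v u" if "u \<in> verts G" "v \<in> verts G" "near ?H 3 u v" for u v
    using that near_3_iff[OF H, of u v] near_3_iff[OF H, of v u] unfolding verts_delete_edges
    by blast
  have xv: "near ?H 3 x v" if "v \<in> verts G" "v \<noteq> x" "v \<noteq> y" for v
    using off[of a v] ax that V a by (subst near_3_iff[OF H]) auto
  have yv: "near ?H 3 y v" if "v \<in> verts G" "v \<noteq> x" "v \<noteq> y" for v
    using off[of b v] ax that V b by (subst near_3_iff[OF H]) auto
  have uv: "near ?H 3 u v"
    if "u \<in> verts G" "v \<in> verts G" "u \<noteq> x" "u \<noteq> y" "v \<noteq> x" "v \<noteq> y" for u v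
    using off[of u v] that by (subst near_3_iff[OF H]) auto
  have refl: "near ?H 3 u u" if "u \<in> verts G" for u
    using that by (subst near_3_iff[OF H]) auto
  show ?thesis
    unfolding all_within_def verts_delete_edges
  proof (intro ballI)
    fix u v assume uv': "u \<in> verts G" "v \<in> verts G"
    consider "u = v" | "u = x" | "u = y" | "v = x" | "v = y"
      | "u \<noteq> x" "u \<noteq> y" "v \<noteq> x" "v \<noteq> y" by blast
    then show "near ?H 3 u v"
    proof cases
      case 1 then show ?thesis using refl uv' by simp
    next
      case 2 then show ?thesis using xv[of v] xy refl uv' by metis
    next
      case 3 then show ?thesis using yv[of v] sym[OF V(1,2) xy] refl uv' by metis
    next
      case 4 then show ?thesis
        using sym[OF V(1) uv'(1) xv[OF uv'(1)]] sym[OF V(1,2) xy] refl uv' by metis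
    next
      case 5 then show ?thesis
        using sym[OF V(2) uv'(1) yv[OF uv'(1)]] xy refl uv' by metis
    next
      case 6 then show ?thesis using uv uv' by simp
    qed
  qed
qed

lemma all_within_3_delete_triangle_edge:
  assumes "simple_graph G" "all_within G 2" "triangle G x y z"
  shows "all_within (delete_edges G {{x, y}}) 3"
proof (rule all_within_3_delete_edge[OF assms(1,2)])
  have t: "adj G x y" "adj G y z" "adj G x z" using assms by (auto simp: triangle_def)
  then have V: "x \<noteq> z" "y \<noteq> z" "x \<in> verts G" "y \<in> verts G" "x \<noteq> y"
    using adj_vertsD[OF assms(1)] by blast+
  show "adj G x y" "adj G x z" "z \<noteq> y" "adj G y z" "z \<noteq> x" using t V by auto
  show "near (delete_edges G {{x, y}}) 3 x y"
    using t V adj_sym[of G y z]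
    by (subst near_3_iff[OF simple_graph_delete_edges[OF assms(1)]])
       (auto simp: adj_delete_edge)
qed

text \<open>The detour is x w z y, and w and z serve as the further neighbours of x and y.\<close>

lemma all_within_3_delete_four_cycle_edge:
  assumes "simple_graph G" "all_within G 2" "four_cycle G x y z w"
  shows "all_within (delete_edges G {{x, y}}) 3"
proof (rule all_within_3_delete_edge[OF assms(1,2)])
  have t: "adj G x y" "adj G y z" "adj G z w" "adj G w x" "x \<noteq> z" "y \<noteq> w"
    using assms by (auto simp: four_cycle_def)
  then have V: "x \<in> verts G" "y \<in> verts G" "x \<noteq> w" "y \<noteq> z" "x \<noteq> y"
    using adj_vertsD[OF assms(1)] by blast+
  show "adj G x y" "adj G x w" "w \<noteq> y" "adj G y z" "z \<noteq> x" using t V adj_sym[of G x w] by auto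
  have "adj G x w" "adj G w z" "adj G z y" using t adj_sym[of G] by blast+
  then have "adj (delete_edges G {{x, y}}) x w \<and> adj (delete_edges G {{x, y}}) w z
      \<and> adj (delete_edges G {{x, y}}) z y"
    using t V by (auto simp: adj_delete_edge)
  then show "near (delete_edges G {{x, y}}) 3 x y"
    using V by (subst near_3_iff[OF simple_graph_delete_edges[OF assms(1)]]) auto
qed

text \<open>Without short cycles, two vertices at distance 2 have a unique common neighbour. So if \<open>x z y\<close> is a
  path left after deleting \<open>xy\<close>, and \<open>v\<close> is a further neighbour of one of its vertices, then deleting
  \<open>xz\<close> or \<open>yz\<close> instead destroys the only path of length 2 from \<open>v\<close> to the far end of that edge.\<close>

lemma not_all_within_2_delete_other_edge:
  assumes G: "simple_graph G" and xy: "adj G x y"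
    and ns: "\<not> short_cycle (delete_edges G {{x, y}})"
    and tw: "all_within (delete_edges G {{x, y}}) 2"
    and four: "4 \<le> card (verts G)"
  obtains z where "triangle G x y z"
    "\<not> all_within (delete_edges G {{x, z}}) 2 \<or> \<not> all_within (delete_edges G {{y, z}}) 2"
proof -
  let ?H = "delete_edges G {{x, y}}"
  have H: "simple_graph ?H" by (rule simple_graph_delete_edges[OF G])
  note V = adj_vertsD[OF G] and VH = adj_vertsD[OF H]
  have no3: "\<not> (adj ?H a b \<and> adj ?H b c \<and> adj ?H a c)" for a b c
    using ns by (auto simp: short_cycle_def triangle_def)
  have no4: "\<not> (adj ?H a b \<and> adj ?H b c \<and> adj ?H c d \<and> adj ?H d a \<and> a \<noteq> c \<and> b \<noteq> d)" for a b c d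
    using ns by (auto simp: short_cycle_def four_cycle_def)
  have two: "u = v \<or> adj ?H u v \<or> (\<exists>m. adj ?H u m \<and> adj ?H m v)"
    if "u \<in> verts G" "v \<in> verts G" for u v
    using tw that near_2_iff[OF H] by (auto simp: all_within_def)
  have "\<not> adj ?H x y" by (simp add: adj_delete_edge)
  then have "\<exists>m. adj ?H x m \<and> adj ?H m y"
    using two[of x y] V[OF xy] by simp
  then obtain z where z: "adj ?H x z" "adj ?H z y"
    by blast
  then have zG: "adj G x z" "adj G z y" "x \<noteq> z" "y \<noteq> z" "x \<noteq> y" "z \<in> verts G"
    using VH[OF z(1)] VH[OF z(2)] V[OF xy] z by (simp_all add: adj_delete_edge)
  have "card {x, y, z} \<le> 3" by (simp add: card_insert_if)
  then have "\<not> verts G \<subseteq> {x, y, z}"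
    using four card_mono[of "{x, y, z}" "verts G"] by auto
  then obtain u where u: "u \<in> verts G" "u \<noteq> x" "u \<noteq> y" "u \<noteq> z" by blast
  \<comment> \<open>On a path of length at most 2 from z to u, the first vertex outside {x, y, z} is
    adjacent to one of these three.\<close>
  obtain v where v: "v \<noteq> x" "v \<noteq> y" "v \<noteq> z" "adj ?H z v \<or> adj ?H x v \<or> adj ?H y v"
  proof -
    consider "adj ?H z u" | m where "adj ?H z m" "adj ?H m u"
      using two[of z u] u zG by blast
    then show ?thesis
    proof cases
      case 1
      then show ?thesis using that u by blast
    next
      case 2
      then show ?thesis using that[of m] that[of u] u VH[OF 2(1)] by blast
    qed
  qed
  have vV: "v \<in> verts G" using v VH by auto
  \<comment> \<open>The other deletions start from G, which is ?H with xy restored. Everything is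
    expressed through ?H, where \<open>no3\<close> and \<open>no4\<close> apply.\<close>
  have GH: "adj G a b \<longleftrightarrow> adj ?H a b \<or> (a = x \<and> b = y) \<or> (a = y \<and> b = x)" for a b
    using xy adj_sym[of G x y] by (auto simp: adj_delete_edge)
  have d: "adj (delete_edges G {{p, q}}) a b \<longleftrightarrow>
      (adj ?H a b \<or> (a = x \<and> b = y) \<or> (a = y \<and> b = x))
      \<and> \<not> (a = p \<and> b = q) \<and> \<not> (a = q \<and> b = p)" for p q a b
    by (simp add: adj_delete_edge[of G p q] GH)
  have sH: "adj ?H a b \<Longrightarrow> adj ?H b a" for a b using adj_sym by metis
  \<comment> \<open>The restored edge xy could only open the path x y v, but y adjacent to v would
    give the triangle y z v in ?H.\<close>
  have "\<not> near (delete_edges G {{x, z}}) 2 x v" if "adj ?H z v"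
  proof -
    have "\<not> adj ?H x v" "\<not> adj ?H y v" using that no3 z sH by blast+
    moreover have "\<not> (adj ?H x m \<and> adj ?H m v)" if "m \<noteq> z" for m
      using no4[of x m v z] \<open>adj ?H z v\<close> that z sH v by blast
    ultimately show ?thesis using v zG
      using vV V[OF xy] by (subst near_2_iff[OF simple_graph_delete_edges[OF G]]) (auto simp: d[of x z])
  qed
  moreover have "\<not> near (delete_edges G {{x, z}}) 2 z v" if "adj ?H x v"
  proof -
    have "\<not> adj ?H z v" using that no3 z sH by blast
    moreover have "\<not> (adj ?H z m \<and> adj ?H m v)" if "m \<noteq> x" for m
      using no4[of x z m v] \<open>adj ?H x v\<close> that z sH v by blast
    ultimately show ?thesis using v zG
      using vV V[OF xy] by (subst near_2_iff[OF simple_graph_delete_edges[OF G]]) (auto simp: d[of x z])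
  qed
  moreover have "\<not> near (delete_edges G {{y, z}}) 2 z v" if "adj ?H y v"
  proof -
    have "\<not> adj ?H z v" using that no3 z sH by blast
    moreover have "\<not> (adj ?H z m \<and> adj ?H m v)" if "m \<noteq> y" for m
      using no4[of y z m v] \<open>adj ?H y v\<close> that z sH v by blast
    ultimately show ?thesis using v zG
      using vV V[OF xy] by (subst near_2_iff[OF simple_graph_delete_edges[OF G]]) (auto simp: d[of y z])
  qed
  ultimately have "\<not> all_within (delete_edges G {{x, z}}) 2 \<or> \<not> all_within (delete_edges G {{y, z}}) 2"
    using v(4) V[OF xy] zG vV unfolding all_within_def verts_delete_edges by blast
  then show ?thesis
    using that[of z] zG xy adj_sym[of G] unfolding triangle_def by blast
qed

text \<open>Induction on the number of edges: the hypotheses pass to the smaller graph precisely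
  when its distances are still at most 2 and a short cycle remains.\<close>

lemma delete_to_diameter_3:
  assumes "simple_graph G" "all_within G 2" "short_cycle G" "4 \<le> card (verts G)"
  shows "\<exists>F\<subseteq>edges G. all_within (delete_edges G F) 3 \<and> \<not> all_within (delete_edges G F) 2"
  using assms
proof (induction "card (edges G)" arbitrary: G rule: less_induct)
  case less
  note G = less.prems(1) and tw = less.prems(2)
  obtain x y where xy: "adj G x y" "all_within (delete_edges G {{x, y}}) 3"
    using less.prems(3) all_within_3_delete_triangle_edge[OF G tw]
      all_within_3_delete_four_cycle_edge[OF G tw]
    unfolding short_cycle_def triangle_def four_cycle_def by blast
  let ?H = "delete_edges G {{x, y}}"
  have e: "{x, y} \<in> edges G" using xy by (simp add: adj_def)
  consider "\<not> all_within ?H 2" | "all_within ?H 2" "short_cycle ?H"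
    | "all_within ?H 2" "\<not> short_cycle ?H" by blast
  then show ?case
  proof cases
    case 1
    then show ?thesis using xy e by (intro exI[of _ "{{x, y}}"]) auto
  next
    case 2
    have "finite (edges G)"
      using G by (intro finite_subset[of "edges G" "Pow (verts G)"]) (auto simp: simple_graph_def)
    then have "card (edges ?H) < card (edges G)"
      using e by (metis card_Diff1_less edges_delete_edges)
    then obtain F where F: "F \<subseteq> edges ?H" "all_within (delete_edges ?H F) 3"
        "\<not> all_within (delete_edges ?H F) 2"
      using less.hyps[of ?H] 2 simple_graph_delete_edges[OF G] less.prems(4) by auto
    have "delete_edges ?H F = delete_edges G (insert {x, y} F)"
      by (auto simp: delete_edges_def)
    then show ?thesis using F e by (intro exI[of _ "insert {x, y} F"]) auto
  next
    case 3
    then obtain z where z: "triangle G x y z"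
      "\<not> all_within (delete_edges G {{x, z}}) 2 \<or> \<not> all_within (delete_edges G {{y, z}}) 2"
      using not_all_within_2_delete_other_edge[OF G xy(1)] less.prems(4) by metis
    \<comment> \<open>The replacement edge is deleted from G, not from ?H; there it lies on a
      triangle, so distances stay at most 3.\<close>
    have "triangle G x z y" "triangle G y z x"
      using z(1) adj_sym[of G] unfolding triangle_def by blast+
    then have "all_within (delete_edges G {{x, z}}) 3" "all_within (delete_edges G {{y, z}}) 3"
      using all_within_3_delete_triangle_edge[OF G tw] by blast+
    moreover have "{x, z} \<in> edges G" "{y, z} \<in> edges G"
      using z(1) by (auto simp: triangle_def adj_def)
    ultimately show ?thesis
      using z(2) by (metis empty_subsetI insert_subset)
  qed
qed

section \<open>Necessity of the criterion\<close>

lemma within_delete_edges: "near (delete_edges G F) k u v \<Longrightarrow> near G k u v"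
  by (induction k arbitrary: v) (auto simp: adj_def)

text \<open>F is nonempty because a distance 3 has appeared. The ends of any edge in F remain joined
  by two or three edges, and the deleted edge closes these to a short cycle.\<close>

lemma short_cycle_of_deletion:
  assumes G: "simple_graph G" and "all_within G 2" "F \<subseteq> edges G"
    and three: "all_within (delete_edges G F) 3" and "\<not> all_within (delete_edges G F) 2"
  shows "short_cycle G"
proof -
  have "delete_edges G {} = G" by (simp add: delete_edges_def)
  with assms(2,5) have "F \<noteq> {}" by auto
  with assms(3) obtain e where e: "e \<in> F" "e \<in> edges G" by auto
  then have "card e = 2" using G by (auto simp: simple_graph_def)
  then obtain x y where xy: "e = {x, y}" by (auto simp: card_2_iff)
  let ?H = "delete_edges G F"
  have "adj G x y" "\<not> adj ?H x y" using e xy by (auto simp: adj_def)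
  have ne: "x \<in> verts G" "y \<in> verts G" "x \<noteq> y" using adj_vertsD[OF G \<open>adj G x y\<close>] by auto
  then have "near ?H 3 x y" using three by (auto simp: all_within_def)
  then have "(\<exists>m. adj ?H x m \<and> adj ?H m y) \<or> (\<exists>m m'. adj ?H x m \<and> adj ?H m m' \<and> adj ?H m' y)"
    using ne \<open>\<not> adj ?H x y\<close> near_3_iff[OF simple_graph_delete_edges[OF G]] by auto
  moreover have "adj ?H a b \<Longrightarrow> adj G a b" for a b by (simp add: adj_def)
  \<comment> \<open>If m were y or m' were x, the edge xy would have survived; hence the 4-cycle is
    nondegenerate.\<close>
  ultimately have "(\<exists>m. adj G x m \<and> adj G m y) \<or>
      (\<exists>m m'. adj G x m \<and> adj G m m' \<and> adj G m' y \<and> m \<noteq> y \<and> m' \<noteq> x)"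
    using \<open>\<not> adj ?H x y\<close> by metis
  then show ?thesis
    using \<open>adj G x y\<close> adj_sym[of G]
    unfolding short_cycle_def triangle_def four_cycle_def by metis
qed

lemma card_verts_ge_4:
  assumes H: "simple_graph H" and "all_within H 3" "\<not> all_within H 2"
  shows "4 \<le> card (verts H)"
proof -
  obtain u v where uv: "u \<in> verts H" "v \<in> verts H" "\<not> near H 2 u v"
    using assms by (auto simp: all_within_def)
  then have "near H 3 u v" using assms by (auto simp: all_within_def)
  then obtain m m' where m: "adj H u m" "adj H m m'" "adj H m' v"
    using uv near_2_iff[OF H uv(1,2)] near_3_iff[OF H uv(1,2)] by blast
  have "distinct [u, m, m', v]" "set [u, m, m', v] \<subseteq> verts H"
    using m uv near_2_iff[OF H uv(1,2)] adj_vertsD[OF H] by auto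
  then show ?thesis
    using H card_mono[of "verts H" "set [u, m, m', v]"] distinct_card[of "[u, m, m', v]"]
    by (simp add: simple_graph_def)
qed

theorem EDA_3_iff:
  assumes G: "simple_graph G" and "connected_graph G"
  shows "EDA 3 G \<longleftrightarrow> all_within G 3 \<and>
    (\<not> all_within G 2 \<or> 4 \<le> card (verts G) \<and> short_cycle G)"
proof -
  have ne: "verts G \<noteq> {}" using assms by (simp add: connected_graph_def)
  have E: "EDA 3 G \<longleftrightarrow> (\<exists>F\<subseteq>edges G. all_within (delete_edges G F) 3
      \<and> \<not> all_within (delete_edges G F) 2)"
    unfolding EDA_def
    using connected_diam_eq_iff[OF simple_graph_delete_edges[OF G], of _ 2] ne by simp
  show ?thesis
  proof
    assume "EDA 3 G"
    then obtain F where F: "F \<subseteq> edges G" "all_within (delete_edges G F) 3"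
      "\<not> all_within (delete_edges G F) 2" using E by blast
    have "all_within G 3" using F(2) within_delete_edges[of G F]
      by (auto simp: all_within_def)
    moreover have "4 \<le> card (verts G)"
      using card_verts_ge_4[OF simple_graph_delete_edges[OF G] F(2,3)] by simp
    ultimately show "all_within G 3 \<and> (\<not> all_within G 2 \<or> 4 \<le> card (verts G) \<and> short_cycle G)"
      using short_cycle_of_deletion[OF G _ F] by blast
  next
    have "delete_edges G {} = G" by (simp add: delete_edges_def)
    moreover assume "all_within G 3 \<and> (\<not> all_within G 2 \<or> 4 \<le> card (verts G) \<and> short_cycle G)"
    ultimately show "EDA 3 G"
      using E delete_to_diameter_3[OF G] by (metis empty_subsetI)
  qed
qed


section \<open>First-order sentences on the random access machine\<close>

datatype fm = Edge nat nat | Equal nat nat | Neg fm | Conj fm fm | Exists fm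

text \<open>Variables are de Bruijn levels: under \<open>d\<close> quantifiers, \<^const>\<open>Exists\<close> binds variable \<open>d\<close>.\<close>

primrec sat :: "nat \<Rightarrow> (nat \<Rightarrow> nat \<Rightarrow> bool) \<Rightarrow> nat \<Rightarrow> (nat \<Rightarrow> nat) \<Rightarrow> fm \<Rightarrow> bool" where
  "sat n E d e (Edge i j) \<longleftrightarrow> E (e i) (e j)"
| "sat n E d e (Equal i j) \<longleftrightarrow> e i = e j"
| "sat n E d e (Neg f) \<longleftrightarrow> \<not> sat n E d e f"
| "sat n E d e (Conj f g) \<longleftrightarrow> sat n E d e f \<and> sat n E d e g"
| "sat n E d e (Exists f) \<longleftrightarrow> (\<exists>a<n. sat n E (Suc d) (e(d := a)) f)"

primrec closed_fm :: "nat \<Rightarrow> fm \<Rightarrow> bool" where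
  "closed_fm d (Edge i j) \<longleftrightarrow> i < d \<and> j < d"
| "closed_fm d (Equal i j) \<longleftrightarrow> i < d \<and> j < d"
| "closed_fm d (Neg f) \<longleftrightarrow> closed_fm d f"
| "closed_fm d (Conj f g) \<longleftrightarrow> closed_fm d f \<and> closed_fm d g"
| "closed_fm d (Exists f) \<longleftrightarrow> closed_fm (Suc d) f"

lemma sat_cong:
  assumes "closed_fm d f" "\<And>i. i < d \<Longrightarrow> e i = e' i"
  shows "sat n E d e f \<longleftrightarrow> sat n E d e' f"
  using assms
proof (induction f arbitrary: d e e')
  case (Exists f)
  have "sat n E (Suc d) (e(d := a)) f \<longleftrightarrow> sat n E (Suc d) (e'(d := a)) f" for a
    using Exists.prems by (intro Exists.IH) auto
  then show ?case by simp
next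
  case (Conj f g)
  show ?case using Conj.IH[of d e e'] Conj.prems by simp
next
  case (Neg f)
  show ?case using Neg.IH[of d e e'] Neg.prems by simp
qed auto

section \<open>Register layout and code generation\<close>

text \<open>With levels, a variable keeps its index under further quantifiers and so owns one fixed
  pair of registers. The pairs start behind the reserved registers 0 to 5.\<close>

abbreviation val :: "nat \<Rightarrow> nat" where "val i \<equiv> 2 * i + 6"
abbreviation row :: "nat \<Rightarrow> nat" where "row i \<equiv> 2 * i + 7"

text \<open>In the code below, register 0 holds truth values, register 5 is scratch space and registers 1 to
  4 hold \<open>n\<^sup>2\<close>, \<open>n\<close>, 1 and 0. The machine cannot multiply, so the value \<open>u\<close> of a variable is kept
  together with the address \<open>u * n\<close> of the corresponding row of the adjacency matrix.\<close>

primrec code_size :: "fm \<Rightarrow> nat" where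
  "code_size (Edge i j) = 2"
| "code_size (Equal i j) = 4"
| "code_size (Neg f) = code_size f + 1"
| "code_size (Conj f g) = code_size f + 1 + code_size g"
| "code_size (Exists f) = code_size f + 9"

text \<open>The code is position dependent: \<open>l\<close> is the address of its first instruction.\<close>

primrec compile :: "nat \<Rightarrow> nat \<Rightarrow> fm \<Rightarrow> program" where
  "compile d l (Edge i j) = [Add 0 (row i) (val j), Load 0 0]"
| "compile d l (Equal i j) =
     [Sub 0 (val i) (val j), Sub 5 (val j) (val i), Add 0 0 5, Sub 0 3 0]"
| "compile d l (Neg f) = compile d l f @ [Sub 0 3 0]"
| "compile d l (Conj f g) =
     (let l' = Suc (l + code_size f)
      in compile d l f @ Jump_zero 0 (l' + code_size g) # compile d l' g)"
| "compile d l (Exists f) =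
     (let l' = l + 2 + code_size f
      in [Const (val d) 0, Const (row d) 0] @ compile (Suc d) (l + 2) f @
         [Jump_zero 0 (l' + 2), Jump_zero 4 (l' + 7),
          Add (val d) (val d) 3, Add (row d) (row d) 2,
          Sub 5 1 (row d), Jump_zero 5 (l' + 7), Jump_zero 4 (l + 2)])"

text \<open>The argument stands for the input length \<open>n * n\<close>, so the n rounds of a loop
  are charged as \<open>n * n\<close>. The 2 pays for the initialisation and the 6 for the
  instructions that a failing round executes after its body.\<close>

primrec cost :: "fm \<Rightarrow> nat poly" where
  "cost (Edge i j) = 2"
| "cost (Equal i j) = 4"
| "cost (Neg f) = cost f + 1"
| "cost (Conj f g) = cost f + 1 + cost g"
| "cost (Exists f) = 2 + [:0, 1:] * (cost f + 6)"

lemma length_compile [simp]: "length (compile d l f) = code_size f"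
  by (induction f arbitrary: d l) (simp_all add: Let_def)

section \<open>Execution within a step bound\<close>

primrec code_at :: "program \<Rightarrow> nat \<Rightarrow> program \<Rightarrow> bool" where
  "code_at P l [] \<longleftrightarrow> True"
| "code_at P l (x # xs) \<longleftrightarrow> l < length P \<and> P ! l = x \<and> code_at P (Suc l) xs"

lemma code_at_append [simp]:
  "code_at P l (xs @ ys) \<longleftrightarrow> code_at P l xs \<and> code_at P (l + length xs) ys"
  by (induction xs arbitrary: l) auto

lemma code_at_self: "code_at (xs @ ys) (length xs) ys"
  by (induction ys arbitrary: xs) (auto, metis append_Cons append_Nil append_assoc length_append_singleton)

text \<open>Only an upper bound on the steps, so that branches of different length and loops left
  early share one budget. Since halted configurations are fixed, it becomes an exact count in
  \<open>runs_halted\<close>.\<close>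

definition runs :: "program \<Rightarrow> nat \<Rightarrow> config \<Rightarrow> config \<Rightarrow> bool" where
  "runs P t c c' \<longleftrightarrow> (\<exists>s\<le>t. (step P ^^ s) c = c')"

lemma runs_refl [simp]: "runs P t c c"
  unfolding runs_def by (intro exI[of _ 0]) auto

lemma runs_trans:
  assumes "runs P s a b" "runs P t b c" "s + t \<le> u"
  shows "runs P u a c"
proof -
  obtain s' t' where "s' \<le> s" "(step P ^^ s') a = b" "t' \<le> t" "(step P ^^ t') b = c"
    using assms by (auto simp: runs_def)
  then show ?thesis
    unfolding runs_def using assms(3)
    by (intro exI[of _ "t' + s'"]) (auto simp: funpow_add)
qed

lemma runs_step:
  assumes "l < length P" "0 < t" "runs P (t - 1) (exec (P ! l) (Config l R M)) c"
  shows "runs P t (Config l R M) c"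
proof (rule runs_trans[OF _ assms(3)])
  show "runs P 1 (Config l R M) (exec (P ! l) (Config l R M))"
    unfolding runs_def using assms(1)
    by (intro exI[of _ 1]) (simp add: step_def halted_def)
  show "1 + (t - 1) \<le> t" using assms(2) by simp
qed

section \<open>Correctness of the compiled code\<close>

text \<open>The row condition can range over all i because the registers of variables not yet bound
  start at 0.\<close>

definition regs_ok :: "nat \<Rightarrow> (nat \<Rightarrow> nat) \<Rightarrow> bool" where
  "regs_ok n R \<longleftrightarrow> R 1 = n * n \<and> R 2 = n \<and> R 3 = 1 \<and> R 4 = 0 \<and> (\<forall>i. R (row i) = R (val i) * n)"

definition mem_ok :: "nat \<Rightarrow> (nat \<Rightarrow> nat \<Rightarrow> bool) \<Rightarrow> (nat \<Rightarrow> nat) \<Rightarrow> bool" where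
  "mem_ok n E M \<longleftrightarrow> (\<forall>u<n. \<forall>v<n. M (u * n + v) = of_bool (E u v))"

text \<open>Only variables below d are preserved: quantifiers inside f take the registers from level
  d on, and successive subformulas reuse them.\<close>

definition evaluates ::
  "program \<Rightarrow> (nat \<Rightarrow> nat) \<Rightarrow> nat \<Rightarrow> (nat \<Rightarrow> nat \<Rightarrow> bool) \<Rightarrow> nat \<Rightarrow> fm \<Rightarrow> nat \<Rightarrow> (nat \<Rightarrow> nat) \<Rightarrow> bool" where
  "evaluates P M n E d f l R \<longleftrightarrow>
     (\<exists>R'. runs P (poly (cost f) (n * n)) (Config l R M) (Config (l + code_size f) R' M) \<and>
           regs_ok n R' \<and> R' 0 = of_bool (sat n E d (\<lambda>i. R (val i)) f) \<and>
           (\<forall>i<d. R' (val i) = R (val i)))"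

lemma val_row_neq [simp]: "val i \<noteq> row j" "row i \<noteq> val j"
  by presburger+

text \<open>The loop is described from an arbitrary current candidate, so the answer covers only the
  candidates from there on, and the induction is on their number. \<open>body\<close> ranges over
  all register contents because each round starts from what the previous one left.\<close>

lemma evaluates_Exists_loop:
  fixes P M n E d l f
  defines "l' \<equiv> l + 2 + code_size f" and "T \<equiv> poly (cost f) (n * n)"
  assumes P: "code_at P l (compile d l (Exists f))"
    and body: "\<forall>R. regs_ok n R \<longrightarrow> (\<forall>i<Suc d. R (val i) < n) \<longrightarrow> evaluates P M n E (Suc d) f (l + 2) R"
    and cl: "closed_fm (Suc d) f"
    and R: "regs_ok n R" "\<forall>i<d. R (val i) < n" "R (val d) < n"
  shows "\<exists>R'. runs P ((n - R (val d)) * (T + 6)) (Config (l + 2) R M) (Config (l' + 7) R' M) \<and>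
    regs_ok n R' \<and> R' 0 = of_bool (\<exists>a<n. R (val d) \<le> a \<and> sat n E (Suc d) ((\<lambda>i. R (val i))(d := a)) f) \<and>
    (\<forall>i<d. R' (val i) = R (val i))"
  using R
proof (induction "n - R (val d)" arbitrary: R rule: less_induct)
  case less
  let ?e = "\<lambda>i. R (val i)"
  have "?e = ?e(d := R (val d))" by auto
  have "\<forall>i<Suc d. R (val i) < n" using less.prems(2,3) by (simp add: less_Suc_eq)
  then have "evaluates P M n E (Suc d) f (l + 2) R" using body less.prems(1) by blast
  then obtain R1 where R1: "runs P T (Config (l + 2) R M) (Config l' R1 M)" "regs_ok n R1"
      "R1 0 = of_bool (sat n E (Suc d) ?e f)" "\<forall>i<Suc d. R1 (val i) = R (val i)"
    unfolding evaluates_def l'_def T_def by blast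
  have c: "l' < length P" "P ! l' = Jump_zero 0 (l' + 2)"
    "Suc l' < length P" "P ! (Suc l') = Jump_zero 4 (l' + 7)"
    "Suc (Suc l') < length P" "P ! (Suc (Suc l')) = Add (val d) (val d) 3"
    "Suc (Suc (Suc l')) < length P" "P ! (Suc (Suc (Suc l'))) = Add (row d) (row d) 2"
    "Suc (Suc (Suc (Suc l'))) < length P" "P ! (Suc (Suc (Suc (Suc l')))) = Sub 5 1 (row d)"
    "Suc (Suc (Suc (Suc (Suc l')))) < length P" "P ! (Suc (Suc (Suc (Suc (Suc l'))))) = Jump_zero 5 (l' + 7)"
    "Suc (Suc (Suc (Suc (Suc (Suc l'))))) < length P" "P ! (Suc (Suc (Suc (Suc (Suc (Suc l')))))) = Jump_zero 4 (l + 2)"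
    using P by (simp_all add: l'_def Let_def)
  have n: "0 < n - R (val d)" using less.prems by simp
  have R14: "R1 4 = 0" using R1(2) by (simp add: regs_ok_def)
  show ?case
  proof (cases "sat n E (Suc d) ?e f")
    case True
    \<comment> \<open>Register 0 is 1, so the first jump falls through to an exit made unconditional
      by testing register 4, which is always 0. The answer is already in place.\<close>
    have "runs P 2 (Config l' R1 M) (Config (l' + 7) R1 M)"
      using True R1(3) R14
      by (intro runs_step[OF c(1)]) (simp_all add: c runs_step[OF c(3)])
    then have "runs P ((n - R (val d)) * (T + 6)) (Config (l + 2) R M) (Config (l' + 7) R1 M)"
      by (rule runs_trans[OF R1(1)]) (use n in \<open>cases "n - R (val d)"; simp\<close>)
    moreover have "\<exists>a<n. R (val d) \<le> a \<and> sat n E (Suc d) (?e(d := a)) f"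
      using True less.prems \<open>?e = ?e(d := R (val d))\<close> by (intro exI[of _ "R (val d)"]) auto
    ultimately show ?thesis
      using R1 True by (intro exI[of _ R1]) auto
  next
    case False
    \<comment> \<open>The state at the loop test. The test compares the row address with
      \<open>n * n\<close>: register 5 is 0 once the candidate has reached n.\<close>
    define R2 where "R2 = R1(val d := Suc (R1 (val d)), row d := R1 (row d) + n,
      5 := n * n - (R1 (row d) + n))"
    have R2: "regs_ok n R2" "R2 (val d) = Suc (R (val d))" "\<forall>i<d. R2 (val i) = R (val i)"
        "R2 0 = 0" "R2 4 = 0"
        "R2 5 = n * n - Suc (R (val d)) * n"
      using R1 False by (auto simp: R2_def regs_ok_def)
    have r: "R1 3 = 1" "R1 2 = n" "R1 1 = n * n" using R1(2) by (auto simp: regs_ok_def)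
    have toend: "runs P 4 (Config l' R1 M) (Config (Suc (Suc (Suc (Suc (Suc l'))))) R2 M)"
    proof -
      have "runs P 2 (Config (Suc (Suc (Suc l'))) (R1(val d := Suc (R1 (val d)))) M)
          (Config (Suc (Suc (Suc (Suc (Suc l'))))) R2 M)"
        using r by (intro runs_step[OF c(7)]) (simp_all add: c runs_step[OF c(9)] R2_def)
      then have "runs P 3 (Config (Suc (Suc l')) R1 M) (Config (Suc (Suc (Suc (Suc (Suc l'))))) R2 M)"
        using r by (intro runs_step[OF c(5)]) (simp_all add: c)
      then show ?thesis
        using R1(3) False by (intro runs_step[OF c(1)]) (simp_all add: c)
    qed
    have iter: "runs P (T + 4) (Config (l + 2) R M) (Config (Suc (Suc (Suc (Suc (Suc l'))))) R2 M)"
      by (rule runs_trans[OF R1(1) toend]) simp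
    \<comment> \<open>The body may have overwritten registers of variables above d, but
      \<open>f\<close> does not mention these.\<close>
    have sat_eq: "sat n E (Suc d) ((\<lambda>i. R2 (val i))(d := a)) f \<longleftrightarrow> sat n E (Suc d) (?e(d := a)) f" for a
      by (rule sat_cong[OF cl]) (use R2 in auto)
    show ?thesis
    proof (cases "Suc (R (val d)) < n")
      case True
      have "Suc (R (val d)) * n < n * n" using mult_less_mono1[OF True] True by simp
      then have "R2 5 \<noteq> 0" using R2(6) by linarith
      then have "runs P 2 (Config (Suc (Suc (Suc (Suc (Suc l'))))) R2 M) (Config (l + 2) R2 M)"
        using R2(5) by (intro runs_step[OF c(11)]) (simp_all add: c runs_step[OF c(13)])
      then have loop: "runs P (T + 6) (Config (l + 2) R M) (Config (l + 2) R2 M)"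
        by (rule runs_trans[OF iter]) simp
      obtain R' where R': "runs P ((n - R2 (val d)) * (T + 6)) (Config (l + 2) R2 M) (Config (l' + 7) R' M)"
        "regs_ok n R'"
        "R' 0 = of_bool (\<exists>a<n. R2 (val d) \<le> a \<and> sat n E (Suc d) ((\<lambda>i. R2 (val i))(d := a)) f)"
        "\<forall>i<d. R' (val i) = R2 (val i)"
      proof -
        have "n - R2 (val d) < n - R (val d)" "\<forall>i<d. R2 (val i) < n" "R2 (val d) < n"
          using R2(2,3) True less.prems(2) by auto
        from less.hyps[OF this(1) R2(1) this(2,3)] show ?thesis using that by blast
      qed
      have "n - R (val d) = Suc (n - R2 (val d))" using R2(2) True by simp
      then have "runs P ((n - R (val d)) * (T + 6)) (Config (l + 2) R M) (Config (l' + 7) R' M)"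
        by (intro runs_trans[OF loop R'(1)]) simp
      moreover have "(\<exists>a<n. R2 (val d) \<le> a \<and> sat n E (Suc d) (?e(d := a)) f) \<longleftrightarrow>
          (\<exists>a<n. R (val d) \<le> a \<and> sat n E (Suc d) (?e(d := a)) f)"
        using False \<open>?e = ?e(d := R (val d))\<close> R2(2)
        by (metis Suc_leD Suc_le_eq le_neq_implies_less)
      ultimately show ?thesis
        using R' R2(3) unfolding sat_eq by (intro exI[of _ R']) simp
    next
      case last: False
      then have "n = Suc (R (val d))" using less.prems by simp
      \<comment> \<open>The candidates are exhausted, and register 0 still holds the 0 of the last
        failing body.\<close>
      then have "R2 5 = 0" using R2(6) by simp
      then have "runs P 1 (Config (Suc (Suc (Suc (Suc (Suc l'))))) R2 M) (Config (l' + 7) R2 M)"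
        by (intro runs_step[OF c(11)]) (simp_all add: c)
      then have "runs P ((n - R (val d)) * (T + 6)) (Config (l + 2) R M) (Config (l' + 7) R2 M)"
        by (rule runs_trans[OF iter]) (simp add: \<open>n = _\<close>)
      moreover have "\<not> (\<exists>a<n. R (val d) \<le> a \<and> sat n E (Suc d) (?e(d := a)) f)"
        using False \<open>?e = ?e(d := R (val d))\<close> \<open>n = _\<close>
        by (metis less_Suc_eq_le le_antisym)
      ultimately show ?thesis
        using R2 by (intro exI[of _ R2]) simp
    qed
  qed
qed

lemma evaluates_compile:
  assumes "code_at P l (compile d l f)" "closed_fm d f" "mem_ok n E M" "0 < n"
    "regs_ok n R" "\<forall>i<d. R (val i) < n"
  shows "evaluates P M n E d f l R"
  using assms
proof (induction f arbitrary: d l R)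
  case (Edge i j)
  have "R (row i) + R (val j) = R (val i) * n + R (val j)" "R (val i) < n" "R (val j) < n"
    using Edge by (auto simp: regs_ok_def)
  then have "M (R (row i) + R (val j)) = of_bool (E (R (val i)) (R (val j)))"
    using Edge.prems(3) by (simp add: mem_ok_def)
  then have "runs P 2 (Config l R M)
      (Config (l + 2) (R(0 := of_bool (E (R (val i)) (R (val j))))) M)"
    using Edge.prems(1) by (intro runs_step[of l]) (simp_all add: runs_step[of "Suc l"])
  then show ?case
    unfolding evaluates_def using Edge
    by (intro exI[of _ "R(0 := of_bool (E (R (val i)) (R (val j))))"]) (simp add: regs_ok_def)
next
  case (Equal i j)
  let ?a = "R (val i)" and ?b = "R (val j)"
  let ?R = "R(0 := of_bool (?a = ?b), 5 := ?b - ?a)"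
  have "R 3 = 1" using Equal by (simp add: regs_ok_def)
  \<comment> \<open>One of the two truncated differences is 0, so their sum is the absolute
    difference; subtracting it from 1, truncated, gives the truth value.\<close>
  define S where "S = R(0 := ?a - ?b + (?b - ?a), 5 := ?b - ?a)"
  have S: "R(0 := ?a - ?b, 5 := ?b - ?a, 0 := ?a - ?b + (?b - ?a)) = S"
    "S(0 := S 3 - S 0) = ?R"
    using \<open>R 3 = 1\<close> by (auto simp: S_def)
  have eq4: "l + 4 = Suc (Suc (Suc (Suc l)))" by simp
  have "runs P 1 (Config (Suc (Suc (Suc l))) S M) (Config (l + 4) ?R M)"
    using Equal.prems(1) by (intro runs_step[of "Suc (Suc (Suc l))"]) (simp_all add: S(2) eq4)
  then have "runs P 2 (Config (Suc (Suc l)) (R(0 := ?a - ?b, 5 := ?b - ?a)) M) (Config (l + 4) ?R M)"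
    using Equal.prems(1) S(1) by (intro runs_step[of "Suc (Suc l)"]) simp_all
  then have "runs P 4 (Config l R M) (Config (l + 4) ?R M)"
    using Equal.prems(1) by (intro runs_step[of l]) (simp_all add: runs_step[of "Suc l"])
  then show ?case
    unfolding evaluates_def using Equal
    by (intro exI[of _ ?R]) (simp add: regs_ok_def)
next
  case (Neg f)
  have P: "code_at P l (compile d l f)" "l + code_size f < length P"
    "P ! (l + code_size f) = Sub 0 3 0"
    using Neg.prems(1) by simp_all
  have "evaluates P M n E d f l R" using Neg.IH[OF P(1)] Neg.prems by simp
  then obtain R' where R': "runs P (poly (cost f) (n * n)) (Config l R M) (Config (l + code_size f) R' M)"
    "regs_ok n R'" "R' 0 = of_bool (sat n E d (\<lambda>i. R (val i)) f)" "\<forall>i<d. R' (val i) = R (val i)"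
    unfolding evaluates_def by blast
  let ?R = "R'(0 := of_bool (\<not> sat n E d (\<lambda>i. R (val i)) f))"
  have "R' 3 = 1" using R' by (simp add: regs_ok_def)
  then have "runs P 1 (Config (l + code_size f) R' M) (Config (Suc (l + code_size f)) ?R M)"
    using R'(3) by (intro runs_step[OF P(2)]) (simp_all add: P(3))
  then have "runs P (poly (cost f) (n * n) + 1) (Config l R M) (Config (Suc (l + code_size f)) ?R M)"
    by (rule runs_trans[OF R'(1)]) simp
  then show ?case
    unfolding evaluates_def using R'
    by (intro exI[of _ ?R]) (simp add: regs_ok_def)
next
  case (Conj f g)
  define l' where "l' = Suc (l + code_size f)"
  have P: "code_at P l (compile d l f)" "l + code_size f < length P"
    "P ! (l + code_size f) = Jump_zero 0 (l' + code_size g)" "code_at P l' (compile d l' g)"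
    using Conj.prems(1) by (simp_all add: l'_def Let_def)
  have "evaluates P M n E d f l R" using Conj.IH(1)[OF P(1)] Conj.prems by simp
  then obtain R1 where R1: "runs P (poly (cost f) (n * n)) (Config l R M) (Config (l + code_size f) R1 M)"
    "regs_ok n R1" "R1 0 = of_bool (sat n E d (\<lambda>i. R (val i)) f)" "\<forall>i<d. R1 (val i) = R (val i)"
    unfolding evaluates_def by blast
  have end_eq: "l + code_size (Conj f g) = l' + code_size g" by (simp add: l'_def)
  show ?case
  proof (cases "sat n E d (\<lambda>i. R (val i)) f")
    case True
    have "evaluates P M n E d g l' R1" using Conj.IH(2)[OF P(4)] Conj.prems R1 by simp
    then obtain R2 where R2: "runs P (poly (cost g) (n * n)) (Config l' R1 M) (Config (l' + code_size g) R2 M)"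
      "regs_ok n R2" "R2 0 = of_bool (sat n E d (\<lambda>i. R1 (val i)) g)" "\<forall>i<d. R2 (val i) = R1 (val i)"
      unfolding evaluates_def by blast
    have "runs P (1 + poly (cost g) (n * n)) (Config (l + code_size f) R1 M) (Config (l' + code_size g) R2 M)"
      using True R1(3) R2(1) by (intro runs_step[OF P(2)]) (simp_all add: P(3) l'_def)
    then have "runs P (poly (cost (Conj f g)) (n * n)) (Config l R M) (Config (l' + code_size g) R2 M)"
      by (rule runs_trans[OF R1(1)]) simp
    \<comment> \<open>The second conjunct runs on the registers left by the first, which agree with
      R on all variables in scope.\<close>
    moreover have "sat n E d (\<lambda>i. R1 (val i)) g \<longleftrightarrow> sat n E d (\<lambda>i. R (val i)) g"
      using Conj.prems(2) R1(4) by (intro sat_cong) auto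
    ultimately show ?thesis
      unfolding evaluates_def end_eq using True R1 R2 by (intro exI[of _ R2]) simp
  next
    case False
    have "runs P 1 (Config (l + code_size f) R1 M) (Config (l' + code_size g) R1 M)"
      using False R1(3) by (intro runs_step[OF P(2)]) (simp_all add: P(3))
    then have "runs P (poly (cost (Conj f g)) (n * n)) (Config l R M) (Config (l' + code_size g) R1 M)"
      by (rule runs_trans[OF R1(1)]) simp
    then show ?thesis
      unfolding evaluates_def end_eq using False R1 by (intro exI[of _ R1]) simp
  qed
next
  case (Exists f)
  define T where "T = poly (cost f) (n * n)"
  define S where "S = R(val d := 0, row d := 0)"
  have S: "S (val d) = 0" "\<forall>i<d. S (val i) = R (val i)" "regs_ok n S"
    using Exists.prems by (auto simp: S_def regs_ok_def)
  have env: "(\<lambda>i. S (val i))(d := a) = (\<lambda>i. R (val i))(d := a)" for a by (auto simp: S_def)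
  have P: "l < length P" "P ! l = Const (val d) 0" "Suc l < length P" "P ! Suc l = Const (row d) 0"
    "code_at P (l + 2) (compile (Suc d) (l + 2) f)"
    using Exists.prems(1) by (simp_all add: Let_def)
  have cl: "closed_fm (Suc d) f" using Exists.prems by simp
  have body: "\<forall>R. regs_ok n R \<longrightarrow> (\<forall>i<Suc d. R (val i) < n) \<longrightarrow> evaluates P M n E (Suc d) f (l + 2) R"
    using Exists.IH[OF P(5) cl] Exists.prems by blast
  have "\<forall>i<d. S (val i) < n" "S (val d) < n" using S Exists.prems by auto
  note loop = evaluates_Exists_loop[OF Exists.prems(1) body cl S(3) this]
  obtain R' where R': "runs P (n * (T + 6)) (Config (l + 2) S M) (Config (l + 2 + code_size f + 7) R' M)"
    "regs_ok n R'" "R' 0 = of_bool (\<exists>a<n. 0 \<le> a \<and> sat n E (Suc d) ((\<lambda>i. R (val i))(d := a)) f)"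
    "\<forall>i<d. R' (val i) = S (val i)"
    using loop unfolding S(1) env T_def[symmetric] diff_zero by blast
  have "runs P 2 (Config l R M) (Config (l + 2) S M)"
    unfolding S_def by (intro runs_step[OF P(1)]) (simp_all add: P(2,4) runs_step[OF P(3)])
  then have "runs P (poly (cost (Exists f)) (n * n)) (Config l R M) (Config (l + 2 + code_size f + 7) R' M)"
    by (rule runs_trans[OF _ R'(1)]) (use \<open>0 < n\<close> in \<open>simp add: T_def\<close>)
  moreover have "l + 2 + code_size f + 7 = l + code_size (Exists f)" by simp
  ultimately show ?case
    unfolding evaluates_def using R' S(2) by (intro exI[of _ R']) (simp only: sat.simps, simp)
qed

section \<open>Recovering n from the input length\<close>

text \<open>Adding register 4, still 0, copies the input length to register 1. The loop starts at
  address 3 with \<open>k * k\<close> in register 0 and k in register 2; the exit address 10 is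
  where the compiled sentence begins.\<close>

definition prelude :: program where
  "prelude = [Add 1 0 4, Const 3 1, Const 0 0, Sub 5 1 0, Jump_zero 5 10,
     Add 0 0 2, Add 0 0 2, Add 0 0 3, Add 2 2 3, Jump_zero 4 3]"

text \<open>The prelude finds \<open>n\<close> from the input length \<open>n\<^sup>2\<close> by summing odd numbers.\<close>

lemma prelude_loop:
  assumes P: "code_at P 0 prelude"
    and "R 0 = k * k" "R 2 = k" "R 1 = n * n" "R 3 = 1" "R 4 = 0" "\<forall>i\<ge>6. R i = 0" "k \<le> n"
  shows "\<exists>R'. runs P (7 * (n - k) + 2) (Config 3 R M) (Config 10 R' M) \<and> regs_ok n R'"
  using assms(2-)
proof (induction "n - k" arbitrary: R k)
  case 0
  then have k: "k = n" by simp
  let ?R = "R(5 := 0)"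
  have "runs P 2 (Config 3 R M) (Config 10 ?R M)"
    using P 0 k
    by (intro runs_step) (auto simp: prelude_def eval_nat_numeral intro!: runs_step)
  moreover have "regs_ok n ?R" using 0 k by (auto simp: regs_ok_def)
  moreover have "7 * (n - k) + 2 = 2" using k by simp
  ultimately show ?case by metis
next
  case (Suc m)
  then have kn: "k < n" by simp
  let ?R = "R(5 := n * n - k * k, 0 := Suc k * Suc k, 2 := Suc k)"
  have c: "3 < length P" "P ! 3 = Sub 5 1 0" "4 < length P" "P ! 4 = Jump_zero 5 10"
    "5 < length P" "P ! 5 = Add 0 0 2" "6 < length P" "P ! 6 = Add 0 0 2"
    "7 < length P" "P ! 7 = Add 0 0 3" "8 < length P" "P ! 8 = Add 2 2 3"
    "9 < length P" "P ! 9 = Jump_zero 4 3"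
    using P by (simp_all add: prelude_def eval_nat_numeral)
  have "k * k < n * n" using kn by (simp add: mult_strict_mono)
  define A B C D where "A = R(5 := n * n - k * k)" and "B = A(0 := k * k + k)"
    and "C = A(0 := k * k + k + k)" and "D = A(0 := k * k + k + k + 1)"
  note defs = A_def B_def C_def D_def
  have D: "?R = D(2 := Suc k)" by (auto simp: defs)
  have s9: "runs P 1 (Config 9 ?R M) (Config 3 ?R M)"
    using Suc.prems by (intro runs_step[OF c(13)]) (simp_all add: c)
  have "runs P 2 (Config 8 D M) (Config 3 ?R M)"
    using s9 Suc.prems unfolding D
    by (intro runs_step[OF c(11)]) (simp_all add: c defs fun_upd_twist)
  then have "runs P 3 (Config 7 C M) (Config 3 ?R M)"
    using Suc.prems by (intro runs_step[OF c(9)]) (simp_all add: c defs fun_upd_twist)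
  then have "runs P 4 (Config 6 B M) (Config 3 ?R M)"
    using Suc.prems by (intro runs_step[OF c(7)]) (simp_all add: c defs fun_upd_twist)
  then have "runs P 5 (Config 5 A M) (Config 3 ?R M)"
    using Suc.prems by (intro runs_step[OF c(5)]) (simp_all add: c defs fun_upd_twist)
  then have "runs P 6 (Config 4 A M) (Config 3 ?R M)"
    using \<open>k * k < n * n\<close> by (intro runs_step[OF c(3)]) (simp_all add: c A_def)
  then have loop: "runs P 7 (Config 3 R M) (Config 3 ?R M)"
    using Suc.prems by (intro runs_step[OF c(1)]) (simp_all add: c A_def)
  have "\<exists>R'. runs P (7 * (n - Suc k) + 2) (Config 3 ?R M) (Config 10 R' M) \<and> regs_ok n R'"
    by (rule Suc.hyps(1)) (use Suc.hyps(2) Suc.prems kn in auto)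
  then obtain R' where R': "runs P (7 * (n - Suc k) + 2) (Config 3 ?R M) (Config 10 R' M)" "regs_ok n R'"
    by blast
  have "runs P (7 * (n - k) + 2) (Config 3 R M) (Config 10 R' M)"
    by (rule runs_trans[OF loop R'(1)]) (use kn in simp)
  then show ?case using R' by blast
qed

lemma prelude_correct:
  assumes P: "code_at P 0 prelude"
  shows "\<exists>R. runs P (7 * n + 5) (Config 0 (\<lambda>i. if i = 0 then n * n else 0) M) (Config 10 R M) \<and>
    regs_ok n R"
proof -
  define R0 R1 R2 R3 where "R0 = (\<lambda>i::nat. if i = 0 then n * n else 0)"
    and "R1 = R0(1 := n * n)" and "R2 = R1(3 := 1)" and "R3 = R2(0 := 0)"
  note defs = R0_def R1_def R2_def R3_def
  have c: "0 < length P" "P ! 0 = Add 1 0 4" "1 < length P" "P ! 1 = Const 3 1"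
    "2 < length P" "P ! 2 = Const 0 0"
    using P by (simp_all add: prelude_def eval_nat_numeral)
  have e: "exec (Add 1 0 4) (Config 0 R0 M) = Config 1 R1 M"
    "exec (Const 3 1) (Config 1 R1 M) = Config 2 R2 M"
    "exec (Const 0 0) (Config 2 R2 M) = Config 3 R3 M"
    by (simp_all add: defs)
  have "runs P 1 (Config 2 R2 M) (Config 3 R3 M)"
    by (rule runs_step[OF c(5)]) (unfold c e, simp_all)
  then have "runs P 2 (Config 1 R1 M) (Config 3 R3 M)"
    by (intro runs_step[OF c(3)]) (unfold c e, simp_all)
  then have start: "runs P 3 (Config 0 R0 M) (Config 3 R3 M)"
    by (intro runs_step[OF c(1)]) (unfold c e, simp_all)
  obtain R where R: "runs P (7 * (n - 0) + 2) (Config 3 R3 M) (Config 10 R M)" "regs_ok n R"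
    using prelude_loop[OF P, of R3 0 n M] by (auto simp: defs)
  have "runs P (7 * n + 5) (Config 0 R0 M) (Config 10 R M)"
    by (rule runs_trans[OF start R(1)]) simp
  then show ?thesis using R(2) unfolding R0_def by blast
qed

section \<open>The input matrix and the complete program\<close>

text \<open>In this form \<open>product_nth\<close> locates the entry for u and v at
  \<open>u * n + v\<close>, the address computed by the code for \<open>Edge\<close>.\<close>

lemma adjacency_matrix_product:
  "adjacency_matrix G = map (\<lambda>(u, v). {u, v} \<in> edges G)
     (List.product [0..<card (verts G)] [0..<card (verts G)])"
  by (simp add: adjacency_matrix_def product_concat_map map_concat comp_def)

lemma length_adjacency_matrix: "length (adjacency_matrix G) = card (verts G) * card (verts G)"
  by (simp add: adjacency_matrix_product)

lemma adjacency_matrix_nth: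
  assumes "u < card (verts G)" "v < card (verts G)"
  shows "u * card (verts G) + v < card (verts G) * card (verts G)"
    "adjacency_matrix G ! (u * card (verts G) + v) \<longleftrightarrow> {u, v} \<in> edges G"
proof -
  let ?n = "card (verts G)"
  have "u * ?n + v < Suc u * ?n" using assms by simp
  also have "\<dots> \<le> ?n * ?n" using assms by (intro mult_le_mono1) simp
  finally show "u * ?n + v < ?n * ?n" .
  then show "adjacency_matrix G ! (u * ?n + v) \<longleftrightarrow> {u, v} \<in> edges G"
    using assms by (simp add: adjacency_matrix_product product_nth)
qed

lemma halted_funpow_step: "halted P c \<Longrightarrow> (step P ^^ t) c = c"
  by (induction t) (simp_all add: step_def)

lemma runs_halted:
  assumes "runs P t c c'" "halted P c'" "t \<le> u"
  shows "(step P ^^ u) c = c'"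
proof -
  obtain s where s: "s \<le> t" "(step P ^^ s) c = c'" using assms by (auto simp: runs_def)
  have "(step P ^^ u) c = (step P ^^ (u - s)) ((step P ^^ s) c)"
    using s assms(3) funpow_add[of "u - s" s "step P"] by simp
  then show ?thesis using s halted_funpow_step assms by simp
qed

lemma first_order_poly_time:
  assumes "closed_fm 0 f"
    and Q: "\<And>G. G \<in> connected_instances \<Longrightarrow>
      Q G \<longleftrightarrow> sat (card (verts G)) (\<lambda>u v. {u, v} \<in> edges G) 0 (\<lambda>_. 0) f"
  shows "poly_time_solvable connected_instances Q adjacency_matrix"
  unfolding poly_time_solvable_def
proof (intro exI ballI)
  \<comment> \<open>At \<open>n * n\<close> the polynomial \<open>[:5, 7:]\<close> bounds the
    \<open>7 * n + 5\<close> steps of the prelude.\<close>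
  let ?P = "prelude @ compile 0 10 f" and ?p = "[:5, 7:] + cost f :: nat poly"
  fix G assume G: "G \<in> connected_instances"
  define n E w where "n = card (verts G)" and "E = (\<lambda>u v. {u, v} \<in> edges G)"
    and "w = adjacency_matrix G"
  define M where "M = (\<lambda>a. if a < length w \<and> w ! a then 1 else 0 :: nat)"
  have "n > 0"
    using G by (auto simp: connected_instances_def simple_graph_def connected_graph_def n_def card_gt_0_iff)
  have len: "length w = n * n" by (simp add: w_def n_def length_adjacency_matrix)
  have mem: "mem_ok n E M"
    unfolding mem_ok_def M_def len
    by (simp add: w_def n_def E_def adjacency_matrix_nth)
  have init: "init w = Config 0 (\<lambda>i. if i = 0 then n * n else 0) M"
    unfolding init_def M_def len ..
  have "length prelude = 10" by (simp add: prelude_def)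
  then have P: "code_at ?P 0 prelude" "code_at ?P 10 (compile 0 10 f)"
    using code_at_self[of "[]" ?P] code_at_self[of prelude] by simp_all
  obtain R where R: "runs ?P (7 * n + 5) (init w) (Config 10 R M)" "regs_ok n R"
    unfolding init using prelude_correct[OF P(1)] by blast
  have "evaluates ?P M n E 0 f 10 R"
    using evaluates_compile[OF P(2) assms(1) mem \<open>n > 0\<close> R(2)] by simp
  then obtain R' where R': "runs ?P (poly (cost f) (n * n)) (Config 10 R M)
      (Config (10 + code_size f) R' M)" "R' 0 = of_bool (sat n E 0 (\<lambda>i. R (val i)) f)"
    unfolding evaluates_def by blast
  have h: "halted ?P (Config (10 + code_size f) R' M)" by (simp add: halted_def prelude_def)
  have "runs ?P (poly ?p (n * n)) (init w) (Config (10 + code_size f) R' M)"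
    by (rule runs_trans[OF R(1) R'(1)]) simp
  from runs_halted[OF this h order_refl]
  have final: "(step ?P ^^ poly ?p (length w)) (init w) = Config (10 + code_size f) R' M"
    by (simp only: len)
  \<comment> \<open>A sentence has no free variables, so the leftover register contents can be
    replaced by the zero assignment.\<close>
  have "sat n E 0 (\<lambda>i. R (val i)) f \<longleftrightarrow> Q G"
    unfolding Q[OF G] n_def[symmetric] E_def[symmetric] by (rule sat_cong[OF assms(1)]) simp
  then show "let c = (step ?P ^^ poly ?p (length (adjacency_matrix G))) (init (adjacency_matrix G))
      in halted ?P c \<and> reg c 0 = (if Q G then 1 else 0)"
    using h R'(2) final by (simp add: w_def[symmetric])
qed


section \<open>The criterion as a first-order sentence\<close>

definition Disj :: "fm \<Rightarrow> fm \<Rightarrow> fm" where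
  "Disj f g = Neg (Conj (Neg f) (Neg g))"

lemma sat_Disj [simp]: "sat n E d e (Disj f g) \<longleftrightarrow> sat n E d e f \<or> sat n E d e g"
  by (simp add: Disj_def)

lemma closed_Disj [simp]: "closed_fm d (Disj f g) \<longleftrightarrow> closed_fm d f \<and> closed_fm d g"
  by (simp add: Disj_def)

text \<open>The same recursion as \<open>near\<close>; the fresh level d stands for the intermediate
  vertex.\<close>

primrec near_fm :: "nat \<Rightarrow> nat \<Rightarrow> nat \<Rightarrow> nat \<Rightarrow> fm" where
  "near_fm d 0 i j = Equal i j"
| "near_fm d (Suc k) i j = Exists (Conj (near_fm (Suc d) k i d) (Disj (Equal d j) (Edge d j)))"

lemma closed_near_fm: "i < d \<Longrightarrow> j < d \<Longrightarrow> closed_fm d (near_fm d k i j)"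
  by (induction k arbitrary: d j) auto

lemma sat_near_fm:
  assumes "verts G = {..<n}" "i < d" "j < d"
  shows "sat n (adj G) d e (near_fm d k i j) \<longleftrightarrow> near G k (e i) (e j)"
  using assms(2,3)
proof (induction k arbitrary: d j e)
  case (Suc k)
  have "sat n (adj G) (Suc d) (e(d := a)) (near_fm (Suc d) k i d) \<longleftrightarrow> near G k (e i) a" for a
    using Suc.IH[of "Suc d" d "e(d := a)"] Suc.prems by (simp del: fun_upd_apply add: fun_upd_same fun_upd_other)
  then show ?case using Suc.prems assms(1) by (auto simp: lessThan_def)
qed simp

definition all_within_fm :: "nat \<Rightarrow> fm" where
  "all_within_fm k = Neg (Exists (Exists (Neg (near_fm 2 k 0 1))))"

lemma closed_all_within_fm: "closed_fm 0 (all_within_fm k)"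
  by (simp add: all_within_fm_def closed_near_fm eval_nat_numeral)

lemma sat_all_within_fm:
  assumes "verts G = {..<n}"
  shows "sat n (adj G) 0 e (all_within_fm k) \<longleftrightarrow> all_within G k"
  using sat_near_fm[OF assms, of 0 2 1] assms
  by (auto simp: all_within_fm_def all_within_def lessThan_def numeral_2_eq_2)

definition short_cycle_fm :: fm where
  "short_cycle_fm = Disj
     (Exists (Exists (Exists (Conj (Edge 0 1) (Conj (Edge 1 2) (Edge 0 2))))))
     (Exists (Exists (Exists (Exists (Conj (Conj (Edge 0 1) (Conj (Edge 1 2) (Conj (Edge 2 3) (Edge 3 0))))
       (Conj (Neg (Equal 0 2)) (Neg (Equal 1 3))))))))"

text \<open>\<open>short_cycle\<close> quantifies over all numbers, the sentence only over those
  below n; adjacency in a simple graph confines its ends to the vertices.\<close>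

lemma sat_short_cycle_fm:
  assumes "simple_graph G" "verts G = {..<n}"
  shows "sat n (adj G) 0 e short_cycle_fm \<longleftrightarrow> short_cycle G"
proof -
  have "adj G u v \<Longrightarrow> u < n \<and> v < n" for u v
    using adj_vertsD[OF assms(1)] assms(2) by auto
  then have "(\<exists>x y z. triangle G x y z) \<longleftrightarrow> (\<exists>x<n. \<exists>y<n. \<exists>z<n. triangle G x y z)"
    "(\<exists>x y z w. four_cycle G x y z w) \<longleftrightarrow> (\<exists>x<n. \<exists>y<n. \<exists>z<n. \<exists>w<n. four_cycle G x y z w)"
    unfolding triangle_def four_cycle_def by blast+
  then show ?thesis
    by (simp add: short_cycle_def short_cycle_fm_def triangle_def four_cycle_def)
qed

definition four_vertices_fm :: fm where
  "four_vertices_fm = Exists (Exists (Exists (Exists (Conj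
     (Conj (Neg (Equal 0 1)) (Conj (Neg (Equal 0 2)) (Neg (Equal 0 3))))
     (Conj (Neg (Equal 1 2)) (Conj (Neg (Equal 1 3)) (Neg (Equal 2 3))))))))"

lemma sat_four_vertices_fm: "sat n E 0 e four_vertices_fm \<longleftrightarrow> 4 \<le> n"
proof
  assume "sat n E 0 e four_vertices_fm"
  then obtain a b c d where "a < n" "b < n" "c < n" "d < n" "distinct [a, b, c, d]"
    by (auto simp: four_vertices_fm_def)
  then show "4 \<le> n"
    using card_mono[of "{..<n}" "set [a, b, c, d]"] distinct_card[of "[a, b, c, d]"] by simp
next
  assume "4 \<le> n"
  then have "0 < n" "1 < n" "2 < n" "3 < n" by auto
  then have "\<exists>a<n. \<exists>b<n. \<exists>c<n. \<exists>d<n. distinct [a, b, c, d]"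
    by (intro exI[of _ 0] exI[of _ 1] exI[of _ 2] exI[of _ 3] conjI) simp_all
  then show "sat n E 0 e four_vertices_fm"
    by (simp add: four_vertices_fm_def)
qed

theorem corollary4p4:
  shows "poly_time_solvable connected_instances (EDA 3) adjacency_matrix"
proof (rule first_order_poly_time)
  let ?f = "Conj (all_within_fm 3)
    (Disj (Neg (all_within_fm 2)) (Conj four_vertices_fm short_cycle_fm))"
  show "closed_fm 0 ?f"
    by (simp add: closed_all_within_fm four_vertices_fm_def short_cycle_fm_def)
  fix G :: "nat graph"
  assume "G \<in> connected_instances"
  then obtain n where G: "simple_graph G" "connected_graph G" "verts G = {..<n}"
    unfolding connected_instances_def by blast
  then have n: "card (verts G) = n" by simp
  have adj: "(\<lambda>u v. {u, v} \<in> edges G) = adj G" by (simp add: adj_def fun_eq_iff)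
  show "EDA 3 G \<longleftrightarrow> sat (card (verts G)) (\<lambda>u v. {u, v} \<in> edges G) 0 (\<lambda>_. 0) ?f"
    unfolding adj n sat.simps sat_Disj sat_all_within_fm[OF G(3)] sat_short_cycle_fm[OF G(1,3)]
      sat_four_vertices_fm
    using EDA_3_iff[OF G(1,2)] unfolding n .
qed

end
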